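(* Let $X \xrightarrow{f} Z \xleftarrow{g} Y$ be continuous maps, and let $w\colon Z\to Z'$ be any continuous map. Then $$\mathrm{TC}(w\circ f,\,w\circ g)\le \mathrm{TC}(f,g).$$ Moreover, if there exists a continuous map $r\colon Z'\to Z$ such that $r\circ w\circ f=f$ and $r\circ w\circ g=g$ (for instance, if $r\circ w=\mathrm{id}_Z$), then $$\mathrm{TC}(w\circ f,\,w\circ g)=\mathrm{TC}(f,g).$$
   Context: All maps are continuous, $I=[0,1]$, and path spaces $X^I$ carry the compact-open topology. For a map $p\colon E\to B$, the sectional number $\mathrm{sec}(p)$ is the least integer $k\ge 0$ such that $B$ has an open cover $U_0,\dots,U_k$ with continuous maps $s_i\colon U_i\to E$ satisfying $p\circ s_i=\mathrm{inc}_{U_i}$ (strict equality); $\mathrm{sec}(p)=\infty$ if no such $k$ exists. For maps $f\colon X\to Z$, $g\colon Y\to Z$ put $\Delta^I_{f,g}=\{(\alpha,\beta)\in X^I\times Y^I : f\circ\alpha=g\circ\beta\}$ and $\pi_{f,g}\colon\Delta^I_{f,g}\to X\times Y$, $\pi_{f,g}(\alpha,\beta)=(\alpha(0),\beta(1))$. The bivariate topological complexity is $\mathrm{TC}(f,g):=\mathrm{sec}(\pi_{f,g})$. *)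

theory Defs
  imports "HOL-Analysis.Analysis" "HOL-Library.Extended_Nat"
begin

(* Spaces are abstract topologies; a map is a HOL function of which only the values on the
   topspace of its domain matter. *)

(* Points of X^I must be determined by their values on I = {0..1}, hence extensional. *)
definition paths :: "'a topology \<Rightarrow> (real \<Rightarrow> 'a) set" where
  "paths X = {\<alpha>. pathin X \<alpha> \<and> \<alpha> \<in> extensional {0..1}}"

definition path_space :: "'a topology \<Rightarrow> (real \<Rightarrow> 'a) topology" where
  "path_space X = topology_generated_by
     {{\<alpha> \<in> paths X. \<alpha> ` K \<subseteq> U} | K U. compactin (top_of_set {0..1}) K \<and> openin X U}"

lemma topspace_path_space [simp]: "topspace (path_space X) = paths X"
proof -
  have "\<exists>K U. paths X = {\<alpha> \<in> paths X. \<alpha> ` K \<subseteq> U} \<and> compactin (top_of_set {0..1}) K \<and> openin X U"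
    by (rule exI[of _ "{}"], rule exI[of _ "{}"]) auto
  then show ?thesis
    unfolding path_space_def topology_generated_by_topspace by blast
qed

(* The infimum in enat of the empty set is \<infinity>; of a nonempty set it is its least element. *)
definition sec :: "'e topology \<Rightarrow> 'b topology \<Rightarrow> ('e \<Rightarrow> 'b) \<Rightarrow> enat" where
  "sec E B p = Inf {enat k | k. \<exists>U :: nat \<Rightarrow> 'b set.
      (\<forall>i\<le>k. openin B (U i)) \<and> (\<Union>i\<le>k. U i) = topspace B \<and>
      (\<forall>i\<le>k. \<exists>s. continuous_map (subtopology B (U i)) E s \<and> (\<forall>b\<in>U i. p (s b) = b))}"

(* The topology of the common codomain of f and g does not enter the construction. *)
definition Delta :: "'a topology \<Rightarrow> 'b topology \<Rightarrow> ('a \<Rightarrow> 'c) \<Rightarrow> ('b \<Rightarrow> 'c)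
    \<Rightarrow> ((real \<Rightarrow> 'a) \<times> (real \<Rightarrow> 'b)) topology" where
  "Delta X Y f g = subtopology (prod_topology (path_space X) (path_space Y))
     {(\<alpha>, \<beta>). \<forall>t\<in>{0..1}. f (\<alpha> t) = g (\<beta> t)}"

definition endpoints :: "(real \<Rightarrow> 'a) \<times> (real \<Rightarrow> 'b) \<Rightarrow> 'a \<times> 'b" where
  "endpoints = (\<lambda>(\<alpha>, \<beta>). (\<alpha> 0, \<beta> 1))"

definition TC :: "'a topology \<Rightarrow> 'b topology \<Rightarrow> ('a \<Rightarrow> 'c) \<Rightarrow> ('b \<Rightarrow> 'c) \<Rightarrow> enat" where
  "TC X Y f g = sec (Delta X Y f g) (prod_topology X Y) endpoints"

end

theory Submission
  imports Defs
begin

text \<open>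
  The space \<open>Delta X Y f g\<close> depends on \<open>f\<close> and \<open>g\<close> only through the relation \<open>f x = g y\<close>
  between points of \<open>X\<close> and \<open>Y\<close>: it consists of the pairs of paths that stay in this relation
  at every time. If the relation for \<open>f\<close>, \<open>g\<close> implies the one for \<open>f'\<close>, \<open>g'\<close>, then
  \<open>Delta X Y f g\<close> is a subspace of \<open>Delta X Y f' g'\<close> compatibly with the endpoint maps, so every
  local section for \<open>f\<close>, \<open>g\<close> is one for \<open>f'\<close>, \<open>g'\<close> (lemma \<open>TC_antimono\<close>). Composing with \<open>w\<close>
  can only enlarge the relation, which gives the inequality; if \<open>r\<close> recovers \<open>f\<close> and \<open>g\<close>
  from \<open>w \<circ> f\<close> and \<open>w \<circ> g\<close>, the two relations coincide, which gives equality.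
\<close>

lemma sec_le_of_fibrewise_map:
  fixes B :: "'b topology"
  assumes h: "continuous_map E E' h"
    and p: "\<And>e. e \<in> topspace E \<Longrightarrow> p' (h e) = p e"
  shows "sec E' B p' \<le> sec E B p"
  unfolding sec_def
proof (rule Inf_superset_mono, safe)
  fix k and U :: "nat \<Rightarrow> 'b set"
  assume op: "\<forall>i\<le>k. openin B (U i)" and cov: "(\<Union>i\<le>k. U i) = topspace B"
    and sct: "\<forall>i\<le>k. \<exists>s. continuous_map (subtopology B (U i)) E s \<and> (\<forall>b\<in>U i. p (s b) = b)"
  have "\<exists>s. continuous_map (subtopology B (U i)) E' s \<and> (\<forall>b\<in>U i. p' (s b) = b)"
    if i: "i \<le> k" for i
  proof -
    obtain s where s: "continuous_map (subtopology B (U i)) E s" "\<forall>b\<in>U i. p (s b) = b"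
      using sct i by blast
    have "s b \<in> topspace E" if "b \<in> U i" for b
      using s(1) op i that openin_subset[of B "U i"] by (auto simp: continuous_map_def)
    then have "\<forall>b\<in>U i. p' ((h \<circ> s) b) = b"
      using s(2) p by simp
    then show ?thesis
      using continuous_map_compose[OF s(1) h] by blast
  qed
  then show "\<exists>k'. enat k = enat k' \<and> (\<exists>U. (\<forall>i\<le>k'. openin B (U i)) \<and> (\<Union>i\<le>k'. U i) = topspace B \<and>
      (\<forall>i\<le>k'. \<exists>s. continuous_map (subtopology B (U i)) E' s \<and> (\<forall>b\<in>U i. p' (s b) = b)))"
    using op cov by blast
qed

lemma paths_in_topspace: "\<alpha> \<in> paths X \<Longrightarrow> t \<in> {0..1} \<Longrightarrow> \<alpha> t \<in> topspace X"
  by (auto simp: paths_def pathin_def continuous_map_def)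

lemma continuous_map_Delta_id:
  assumes "\<And>x y. \<lbrakk>x \<in> topspace X; y \<in> topspace Y; f x = g y\<rbrakk> \<Longrightarrow> f' x = g' y"
  shows "continuous_map (Delta X Y f g) (Delta X Y f' g') id"
  unfolding Delta_def
  by (auto simp: continuous_map_in_subtopology continuous_map_from_subtopology
      intro!: assms paths_in_topspace)

text \<open>
  The codomains of \<open>f\<close>, \<open>g\<close> and of \<open>f'\<close>, \<open>g'\<close> may differ, and no continuity is needed, since
  only the relations \<open>f x = g y\<close> and \<open>f' x = g' y\<close> enter.
\<close>
lemma TC_antimono:
  assumes "\<And>x y. \<lbrakk>x \<in> topspace X; y \<in> topspace Y; f x = g y\<rbrakk> \<Longrightarrow> f' x = g' y"
  shows "TC X Y f' g' \<le> TC X Y f g"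
  unfolding TC_def
  by (rule sec_le_of_fibrewise_map[OF continuous_map_Delta_id]) (use assms in auto)

theorem proposition2p23:
  fixes X :: "'a topology" and Y :: "'b topology" and Z :: "'c topology" and Z' :: "'d topology"
    and f :: "'a \<Rightarrow> 'c" and g :: "'b \<Rightarrow> 'c" and w :: "'c \<Rightarrow> 'd"
  assumes "continuous_map X Z f" and "continuous_map Y Z g" and "continuous_map Z Z' w"
  shows "TC X Y (w \<circ> f) (w \<circ> g) \<le> TC X Y f g \<and>
         ((\<exists>r. continuous_map Z' Z r \<and>
             (\<forall>x\<in>topspace X. (r \<circ> w \<circ> f) x = f x) \<and>
             (\<forall>y\<in>topspace Y. (r \<circ> w \<circ> g) y = g y))
          \<longrightarrow> TC X Y (w \<circ> f) (w \<circ> g) = TC X Y f g) \<and>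
         ((\<exists>r. continuous_map Z' Z r \<and> (\<forall>z\<in>topspace Z. (r \<circ> w) z = z))
          \<longrightarrow> TC X Y (w \<circ> f) (w \<circ> g) = TC X Y f g)"
proof (intro conjI impI)
  show le: "TC X Y (w \<circ> f) (w \<circ> g) \<le> TC X Y f g"
    by (rule TC_antimono) simp
  have eq: "TC X Y (w \<circ> f) (w \<circ> g) = TC X Y f g"
    if "\<forall>x\<in>topspace X. (r \<circ> w \<circ> f) x = f x" "\<forall>y\<in>topspace Y. (r \<circ> w \<circ> g) y = g y"
    for r :: "'d \<Rightarrow> 'c"
  proof (rule antisym[OF le], rule TC_antimono)
    fix x y
    assume "x \<in> topspace X" "y \<in> topspace Y" and "(w \<circ> f) x = (w \<circ> g) y"
    then show "f x = g y"
      using that by (metis comp_apply)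
  qed
  show "TC X Y (w \<circ> f) (w \<circ> g) = TC X Y f g"
    if "\<exists>r. continuous_map Z' Z r \<and> (\<forall>x\<in>topspace X. (r \<circ> w \<circ> f) x = f x) \<and>
             (\<forall>y\<in>topspace Y. (r \<circ> w \<circ> g) y = g y)"
    using that eq by blast
  show "TC X Y (w \<circ> f) (w \<circ> g) = TC X Y f g"
    if retraction: "\<exists>r. continuous_map Z' Z r \<and> (\<forall>z\<in>topspace Z. (r \<circ> w) z = z)"
  proof -
    obtain r :: "'d \<Rightarrow> 'c" where r: "\<forall>z\<in>topspace Z. (r \<circ> w) z = z"
      using retraction by blast
    show ?thesis
    proof (rule eq[of r])
      show "\<forall>x\<in>topspace X. (r \<circ> w \<circ> f) x = f x"
        using r continuous_map_funspace[OF assms(1)] by auto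
      show "\<forall>y\<in>topspace Y. (r \<circ> w \<circ> g) y = g y"
        using r continuous_map_funspace[OF assms(2)] by auto
    qed
  qed
qed

end
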